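(* Let $a>0$, let $\tau:\mathbb{R}\to\mathbb{R}$ be bounded and continuous, and let $\theta:\mathbb{R}\to\mathbb{R}$ be a bounded $C^1$ function whose derivative $\dot\theta$ is bounded (and continuous). Put $h_0(s,t):=\sqrt{1+t^2[\tau(s)-\dot\theta(s)]^2}$ on $\mathbb{R}\times(-a,a)$. Assume that $\tau-\dot\theta$ is not identically zero and that $a\,\|\tau-\dot\theta\|_\infty<\sqrt2$. Then for every $s_0\in\mathbb{R}$ with $(\tau-\dot\theta)(s_0)\neq 0$ there exists a constant $c>0$, depending on $s_0$, $a$ and $\tau-\dot\theta$, such that for all $\psi\in W_0^{1,2}(\mathbb{R}\times(-a,a))$ $$Q_0[\psi]-E_1\,\|\psi\|_{\mathcal{H}_0}^2\ \ge\ c\,\|\rho^{-1}\psi\|_{\mathcal{H}_0}^2,\qquad \rho(s,t):=\sqrt{1+(s-s_0)^2}.$$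
   Context: $E_1:=\pi^2/(2a)^2$ is the lowest eigenvalue of the Dirichlet Laplacian in $(-a,a)$. The geodesic strip $\Omega_0$ is the Riemannian manifold $\mathbb{R}\times(-a,a)$ with metric $G_0=\mathrm{diag}(h_0^2,1)$ in the coordinates $(s,t)$. The Hilbert space is $\mathcal{H}_0:=L^2(\Omega_0)=L^2(\mathbb{R}\times(-a,a),\,h_0(s,t)\,ds\,dt)$. The quadratic form $Q_0$ is the closure in $\mathcal{H}_0$ of the form defined on $C_0^\infty(\mathbb{R}\times(-a,a))$ by $$Q_0[\psi]=\|h_0^{-1}\partial_1\psi\|_{\mathcal{H}_0}^2+\|\partial_2\psi\|_{\mathcal{H}_0}^2,$$ where $\partial_1=\partial/\partial s$, $\partial_2=\partial/\partial t$; its domain is the Sobolev space $W_0^{1,2}(\mathbb{R}\times(-a,a))$, on which it is given by the same formula. $\|\cdot\|_\infty$ is the supremum norm on $\mathbb{R}$. *)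

theory Defs
  imports "HOL-Analysis.Analysis"
begin

definition L2 :: "'a measure \<Rightarrow> ('a \<Rightarrow> complex) set" where
  "L2 M = {f. f \<in> borel_measurable M \<and> integrable M (\<lambda>x. (norm (f x))\<^sup>2)}"

(* The integral of a non-integrable function is 0, so this is the norm only on L2 M. *)
definition L2norm :: "'a measure \<Rightarrow> ('a \<Rightarrow> complex) \<Rightarrow> real" where
  "L2norm M f = sqrt (\<integral>x. (norm (f x))\<^sup>2 \<partial>M)"

definition dir_deriv :: "'a::real_normed_vector \<Rightarrow> ('a \<Rightarrow> 'b::real_normed_vector) \<Rightarrow> 'a \<Rightarrow> 'b" where
  "dir_deriv v f x = frechet_derivative f (at x) v"

abbreviation partial1 :: "(real \<times> real \<Rightarrow> complex) \<Rightarrow> real \<times> real \<Rightarrow> complex" where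
  "partial1 \<equiv> dir_deriv (1, 0)"

abbreviation partial2 :: "(real \<times> real \<Rightarrow> complex) \<Rightarrow> real \<times> real \<Rightarrow> complex" where
  "partial2 \<equiv> dir_deriv (0, 1)"

primrec C_k :: "nat \<Rightarrow> ('a::euclidean_space \<Rightarrow> 'b::real_normed_vector) \<Rightarrow> bool" where
  "C_k 0 f \<longleftrightarrow> continuous_on UNIV f"
| "C_k (Suc k) f \<longleftrightarrow> f differentiable_on UNIV \<and> (\<forall>v. C_k k (dir_deriv v f))"

(* Functions in C_0^\<infinity>(\<Omega>), extended by zero to the whole space. *)
definition test_functions :: "'a::euclidean_space set \<Rightarrow> ('a \<Rightarrow> complex) set" where
  "test_functions \<Omega> = {\<phi>. (\<forall>k. C_k k \<phi>) \<and>
     compact (closure {x. \<phi> x \<noteq> 0}) \<and> closure {x. \<phi> x \<noteq> 0} \<subseteq> \<Omega>}"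

definition has_weak_deriv ::
    "'a::euclidean_space set \<Rightarrow> 'a \<Rightarrow> ('a \<Rightarrow> complex) \<Rightarrow> ('a \<Rightarrow> complex) \<Rightarrow> bool" where
  "has_weak_deriv \<Omega> v \<psi> g \<longleftrightarrow> (\<forall>\<phi>\<in>test_functions \<Omega>.
     (\<integral>x. \<psi> x * dir_deriv v \<phi> x \<partial>lebesgue_on \<Omega>) = - (\<integral>x. g x * \<phi> x \<partial>lebesgue_on \<Omega>))"

(* The closure of the test functions in the Sobolev space W^{1,2}(\<Omega>): g1 and g2 are the weak
   partial derivatives of \<psi>, and \<phi> n converges to \<psi> in the W^{1,2}-norm. *)
definition W012 :: "(real \<times> real) set \<Rightarrow> (real \<times> real \<Rightarrow> complex) set" where
  "W012 \<Omega> = {\<psi> \<in> L2 (lebesgue_on \<Omega>).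
     \<exists>g1\<in>L2 (lebesgue_on \<Omega>). \<exists>g2\<in>L2 (lebesgue_on \<Omega>).
       has_weak_deriv \<Omega> (1, 0) \<psi> g1 \<and> has_weak_deriv \<Omega> (0, 1) \<psi> g2 \<and>
       (\<exists>\<phi>. (\<forall>n. \<phi> n \<in> test_functions \<Omega>) \<and>
          (\<lambda>n. L2norm (lebesgue_on \<Omega>) (\<lambda>x. \<phi> n x - \<psi> x)) \<longlonglongrightarrow> 0 \<and>
          (\<lambda>n. L2norm (lebesgue_on \<Omega>) (\<lambda>x. partial1 (\<phi> n) x - g1 x)) \<longlonglongrightarrow> 0 \<and>
          (\<lambda>n. L2norm (lebesgue_on \<Omega>) (\<lambda>x. partial2 (\<phi> n) x - g2 x)) \<longlonglongrightarrow> 0)}"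

(* The closure in L2 M of a closable nonnegative quadratic form q with domain D: \<psi> lies in its
   domain, with value l, iff some sequence in D converges to \<psi> in L2 M, is Cauchy with respect
   to q, and has form values tending to l. *)
definition form_closure_graph ::
    "'a measure \<Rightarrow> ('a \<Rightarrow> complex) set \<Rightarrow> (('a \<Rightarrow> complex) \<Rightarrow> real) \<Rightarrow> ('a \<Rightarrow> complex) \<Rightarrow> real \<Rightarrow> bool"
  where
  "form_closure_graph M D q \<psi> l \<longleftrightarrow> \<psi> \<in> L2 M \<and>
     (\<exists>\<phi>. (\<forall>n. \<phi> n \<in> D) \<and>
        (\<lambda>n. L2norm M (\<lambda>x. \<phi> n x - \<psi> x)) \<longlonglongrightarrow> 0 \<and>
        (\<forall>e>0. \<exists>N. \<forall>m\<ge>N. \<forall>n\<ge>N. q (\<lambda>x. \<phi> m x - \<phi> n x) < e) \<and>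
        (\<lambda>n. q (\<phi> n)) \<longlonglongrightarrow> l)"

(* For closable q the value l does not depend on the approximating sequence. *)
definition form_closure ::
    "'a measure \<Rightarrow> ('a \<Rightarrow> complex) set \<Rightarrow> (('a \<Rightarrow> complex) \<Rightarrow> real) \<Rightarrow> ('a \<Rightarrow> complex) \<Rightarrow> real"
  where
  "form_closure M D q \<psi> = (SOME l. form_closure_graph M D q \<psi> l)"

definition strip :: "real \<Rightarrow> (real \<times> real) set" where
  "strip a = UNIV \<times> {-a<..<a}"

definition h0 :: "(real \<Rightarrow> real) \<Rightarrow> (real \<Rightarrow> real) \<Rightarrow> real \<times> real \<Rightarrow> real" where
  "h0 \<tau> \<theta> = (\<lambda>(s, t). sqrt (1 + t\<^sup>2 * (\<tau> s - deriv \<theta> s)\<^sup>2))"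

(* Riemannian volume of the metric diag(h^2, 1) on the strip; its L2 is the space H_0. *)
definition strip_measure :: "real \<Rightarrow> (real \<times> real \<Rightarrow> real) \<Rightarrow> (real \<times> real) measure" where
  "strip_measure a h = density (lebesgue_on (strip a)) (\<lambda>x. ennreal (h x))"

definition Q0_core ::
    "real \<Rightarrow> (real \<times> real \<Rightarrow> real) \<Rightarrow> (real \<times> real \<Rightarrow> complex) \<Rightarrow> real" where
  "Q0_core a h \<phi> =
     (L2norm (strip_measure a h) (\<lambda>x. partial1 \<phi> x / of_real (h x)))\<^sup>2 +
     (L2norm (strip_measure a h) (partial2 \<phi>))\<^sup>2"

definition Q0 ::
    "real \<Rightarrow> (real \<times> real \<Rightarrow> real) \<Rightarrow> (real \<times> real \<Rightarrow> complex) \<Rightarrow> real" where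
  "Q0 a h = form_closure (strip_measure a h) (test_functions (strip a)) (Q0_core a h)"

(* Lowest eigenvalue of the Dirichlet Laplacian in the interval (-a, a). *)
definition E1 :: "real \<Rightarrow> real" where
  "E1 a = pi\<^sup>2 / (2 * a)\<^sup>2"

definition rho :: "real \<Rightarrow> real \<times> real \<Rightarrow> real" where
  "rho s0 = (\<lambda>(s, t). sqrt (1 + (s - s0)\<^sup>2))"

end

theory Submission
  imports Defs
begin

text \<open>
  Write \<open>k = \<tau> - \<theta>'\<close> and \<open>h\<close> for the Jacobian. On test functions the estimate follows by completing
  squares: \<open>\<bar>\<partial>\<^sub>2\<phi> - (q/h) \<phi>\<bar>\<^sup>2 \<ge> 0\<close>, where \<open>q/h\<close> is the logarithmic derivative in \<open>t\<close> of
  \<open>cos (\<pi>t/2a) / \<surd>h\<close>, yields after integration by parts the energy \<open>E\<^sub>1\<close> plus the potential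
  \<open>k\<^sup>2(2 - k\<^sup>2t\<^sup>2) / (4h\<^sup>4)\<close>, which is positive where \<open>k \<noteq> 0\<close> because \<open>a \<bar>k\<bar> < \<surd>2\<close>. Similarly
  \<open>\<bar>\<partial>\<^sub>1\<phi> - g \<phi>\<bar>\<^sup>2 \<ge> 0\<close> with \<open>g(s) = (s - s\<^sub>0) / (2((s - s\<^sub>0)\<^sup>2 + \<beta>\<^sup>2))\<close> yields a Hardy weight that is
  negative only near \<open>s\<^sub>0\<close>, where a small multiple of it is absorbed by the potential. The estimate
  passes to the closure along any approximating sequence, so closability of the form is not needed.
\<close>

section \<open>Square-integrable functions\<close>

lemma L2norm_nonneg [simp]: "0 \<le> L2norm M f"
  by (simp add: L2norm_def)

lemma L2norm_power2: "(L2norm M f)\<^sup>2 = (\<integral>x. (norm (f x))\<^sup>2 \<partial>M)"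
  by (simp add: L2norm_def)

text \<open>Expanding shows that the two sides differ by the square
  \<open>(y * norm u - x * norm v)\<^sup>2 / (x * y)\<close>. The free weights serve to prove
  Minkowski's inequality: with \<open>x\<close>, \<open>y\<close> equal to bounds of two norms, the
  integrated right side becomes \<open>(x + y)\<^sup>2\<close>.\<close>

lemma Young_norm_add:
  fixes u v :: "'b::real_normed_vector"
  assumes "x > 0" "y > 0"
  shows "(norm (u + v))\<^sup>2 \<le> (1 + y / x) * (norm u)\<^sup>2 + (1 + x / y) * (norm v)\<^sup>2"
proof -
  have "(norm (u + v))\<^sup>2 \<le> (norm u + norm v)\<^sup>2"
    by (simp add: norm_triangle_ineq power_mono)
  also have "\<dots> = (1 + y / x) * (norm u)\<^sup>2 + (1 + x / y) * (norm v)\<^sup>2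
      - (y * norm u - x * norm v)\<^sup>2 / (x * y)"
    using assms by (simp add: field_simps power2_eq_square)
  also have "\<dots> \<le> (1 + y / x) * (norm u)\<^sup>2 + (1 + x / y) * (norm v)\<^sup>2"
    using assms by simp
  finally show ?thesis .
qed

lemma L2_add:
  assumes "f \<in> L2 M" "g \<in> L2 M"
  shows "(\<lambda>x. f x + g x) \<in> L2 M"
proof -
  have [measurable]: "f \<in> borel_measurable M" "g \<in> borel_measurable M"
    using assms by (auto simp: L2_def)
  have "integrable M (\<lambda>x. 2 * (norm (f x))\<^sup>2 + 2 * (norm (g x))\<^sup>2)"
    using assms by (auto simp: L2_def)
  then have "integrable M (\<lambda>x. (norm (f x + g x))\<^sup>2)"
    by (rule Bochner_Integration.integrable_bound)
      (use Young_norm_add[of 1 1] in \<open>auto intro!: AE_I2\<close>)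
  then show ?thesis
    by (simp add: L2_def)
qed

lemma L2_mult_bounded:
  fixes u :: "'a \<Rightarrow> complex"
  assumes "f \<in> L2 M" and [measurable]: "u \<in> borel_measurable M"
    and u: "\<And>x. norm (u x) \<le> 1"
  shows "(\<lambda>x. f x * u x) \<in> L2 M" and "L2norm M (\<lambda>x. f x * u x) \<le> L2norm M f"
proof -
  have [measurable]: "f \<in> borel_measurable M" and i: "integrable M (\<lambda>x. (norm (f x))\<^sup>2)"
    using assms(1) by (auto simp: L2_def)
  have le: "(norm (f x * u x))\<^sup>2 \<le> (norm (f x))\<^sup>2" for x
    by (simp add: norm_mult mult_left_le u power_mono)
  have j: "integrable M (\<lambda>x. (norm (f x * u x))\<^sup>2)"
    by (rule Bochner_Integration.integrable_bound[OF i]) (use le in \<open>auto intro!: AE_I2\<close>)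
  then show "(\<lambda>x. f x * u x) \<in> L2 M"
    by (simp add: L2_def)
  show "L2norm M (\<lambda>x. f x * u x) \<le> L2norm M f"
    unfolding L2norm_def by (intro real_sqrt_le_mono integral_mono i j le)
qed

lemma L2_diff:
  assumes "f \<in> L2 M" "g \<in> L2 M"
  shows "(\<lambda>x. f x - g x) \<in> L2 M"
  using L2_add[OF assms(1) L2_mult_bounded(1)[OF assms(2), of "\<lambda>_. -1"]] by simp

lemma L2norm_add_le:
  assumes f: "f \<in> L2 M" and g: "g \<in> L2 M"
  shows "L2norm M (\<lambda>x. f x + g x) \<le> L2norm M f + L2norm M g"
proof (rule field_le_epsilon)
  fix e :: real
  assume "e > 0"
  \<comment> \<open>The shift by \<open>e / 2\<close> keeps both weights positive even when a norm
    vanishes; together the shifts cost exactly \<open>e\<close>.\<close>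
  define x y where "x = L2norm M f + e / 2" and "y = L2norm M g + e / 2"
  have pos: "x > 0" "y > 0"
    using \<open>e > 0\<close> by (auto simp: x_def y_def intro: add_nonneg_pos)
  have if2: "integrable M (\<lambda>x. (norm (f x))\<^sup>2)" and ig: "integrable M (\<lambda>x. (norm (g x))\<^sup>2)"
    using f g by (auto simp: L2_def)
  have "(L2norm M (\<lambda>x. f x + g x))\<^sup>2
      \<le> (\<integral>z. (1 + y / x) * (norm (f z))\<^sup>2 + (1 + x / y) * (norm (g z))\<^sup>2 \<partial>M)"
    unfolding L2norm_power2
    by (intro integral_mono Young_norm_add pos)
      (use L2_add[OF f g] if2 ig in \<open>auto simp: L2_def\<close>)
  also have "\<dots> = (1 + y / x) * (L2norm M f)\<^sup>2 + (1 + x / y) * (L2norm M g)\<^sup>2"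
    unfolding L2norm_power2 using if2 ig by simp
  also have "\<dots> \<le> (1 + y / x) * x\<^sup>2 + (1 + x / y) * y\<^sup>2"
    using pos \<open>e > 0\<close>
    by (intro add_mono mult_left_mono power_mono) (auto simp: x_def y_def)
  also have "\<dots> = (x + y)\<^sup>2"
    using pos by (simp add: field_simps power2_eq_square)
  finally have "L2norm M (\<lambda>x. f x + g x) \<le> x + y"
    by (rule power2_le_imp_le) (use pos in simp)
  then show "L2norm M (\<lambda>x. f x + g x) \<le> L2norm M f + L2norm M g + e"
    by (simp add: x_def y_def)
qed

lemma L2norm_minus_commute: "L2norm M (\<lambda>x. f x - g x) = L2norm M (\<lambda>x. g x - f x)"
  by (simp add: L2norm_def norm_minus_commute)

lemma L2norm_diff_triangle:
  assumes "f \<in> L2 M" "g \<in> L2 M" "k \<in> L2 M"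
  shows "L2norm M (\<lambda>x. f x - k x) \<le> L2norm M (\<lambda>x. f x - g x) + L2norm M (\<lambda>x. g x - k x)"
  using L2norm_add_le[OF L2_diff[OF assms(1,2)] L2_diff[OF assms(2,3)]] by simp

lemma abs_L2norm_diff_le:
  assumes f: "f \<in> L2 M" and g: "g \<in> L2 M"
  shows "\<bar>L2norm M f - L2norm M g\<bar> \<le> L2norm M (\<lambda>x. f x - g x)"
proof -
  have "L2norm M f \<le> L2norm M (\<lambda>x. f x - g x) + L2norm M g"
    using L2norm_add_le[OF L2_diff[OF f g] g] by simp
  moreover have "L2norm M g \<le> L2norm M (\<lambda>x. f x - g x) + L2norm M f"
    using L2norm_add_le[OF L2_diff[OF g f] f] by (simp add: L2norm_minus_commute[of M g])
  ultimately show ?thesis by linarith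
qed

lemma L2norm_tendsto:
  assumes "\<And>n. f n \<in> L2 M" "g \<in> L2 M"
    and "(\<lambda>n. L2norm M (\<lambda>x. f n x - g x)) \<longlonglongrightarrow> 0"
  shows "(\<lambda>n. L2norm M (f n)) \<longlonglongrightarrow> L2norm M g"
proof -
  have "(\<lambda>n. L2norm M (f n) - L2norm M g) \<longlonglongrightarrow> 0"
    by (rule Lim_null_comparison[OF _ assms(3)])
      (use abs_L2norm_diff_le[OF assms(1,2)] in auto)
  then show ?thesis by (simp add: LIM_zero_iff)
qed

lemma L2_tendsto_mult_bounded:
  fixes u :: "'a \<Rightarrow> complex"
  assumes "\<And>n. f n \<in> L2 M" "g \<in> L2 M" "u \<in> borel_measurable M" "\<And>x. norm (u x) \<le> 1"
    and "(\<lambda>n. L2norm M (\<lambda>x. f n x - g x)) \<longlonglongrightarrow> 0"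
  shows "(\<lambda>n. L2norm M (\<lambda>x. f n x * u x - g x * u x)) \<longlonglongrightarrow> 0"
proof (rule Lim_null_comparison[OF _ assms(5)])
  show "\<forall>\<^sub>F n in sequentially. norm (L2norm M (\<lambda>x. f n x * u x - g x * u x)) \<le> L2norm M (\<lambda>x. f n x - g x)"
    using L2_mult_bounded(2)[OF L2_diff[OF assms(1,2)] assms(3,4)]
    by (simp add: left_diff_distrib)
qed

text \<open>Provides the Cauchy condition in \<open>form_closure_graph\<close>. The norm is squared
  because \<open>Q0_core\<close> is a sum of squared norms.\<close>

lemma L2_Cauchy:
  assumes "\<And>n. f n \<in> L2 M" "g \<in> L2 M"
    and "(\<lambda>n. L2norm M (\<lambda>x. f n x - g x)) \<longlonglongrightarrow> 0" "e > 0"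
  shows "\<exists>N. \<forall>m\<ge>N. \<forall>n\<ge>N. (L2norm M (\<lambda>x. f m x - f n x))\<^sup>2 < e"
proof -
  have "\<forall>\<^sub>F n in sequentially. L2norm M (\<lambda>x. f n x - g x) < sqrt e / 2"
    using assms(3,4) by (intro order_tendstoD(2)) auto
  then obtain N where N: "\<And>n. n \<ge> N \<Longrightarrow> L2norm M (\<lambda>x. f n x - g x) < sqrt e / 2"
    by (auto simp: eventually_sequentially)
  have "(L2norm M (\<lambda>x. f m x - f n x))\<^sup>2 < e" if "m \<ge> N" "n \<ge> N" for m n
  proof -
    have "L2norm M (\<lambda>x. f m x - f n x) < sqrt e"
      using L2norm_diff_triangle[OF assms(1)[of m] assms(2) assms(1)[of n]] N[OF that(1)] N[OF that(2)]
      by (simp add: L2norm_minus_commute[of M g])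
    then have "(L2norm M (\<lambda>x. f m x - f n x))\<^sup>2 < (sqrt e)\<^sup>2"
      by (intro power_strict_mono) auto
    then show ?thesis using assms(4) by simp
  qed
  then show ?thesis by blast
qed

section \<open>Norms with respect to a weighted measure\<close>

lemma L2norm_density_power2:
  fixes w :: "'a \<Rightarrow> real"
  assumes "f \<in> borel_measurable M" "w \<in> borel_measurable M" "\<And>x. 0 \<le> w x"
  shows "(L2norm (density M w) f)\<^sup>2 = (\<integral>x. w x * (norm (f x))\<^sup>2 \<partial>M)"
  unfolding L2norm_power2 using assms by (subst integral_density) auto

text \<open>\<open>W012\<close> is built on Lebesgue measure, the form on the Riemannian volume with
  density \<open>h\<close>; this transfers membership and convergence from the first to the second.
  The bounds on \<open>w\<close> are required only on \<open>space M\<close>, because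
  \<open>h\<close> is bounded on the strip but in general not on the whole plane.\<close>

lemma L2_density_bounded:
  fixes w :: "'a \<Rightarrow> real"
  assumes f: "f \<in> L2 M" and w [measurable]: "w \<in> borel_measurable M"
    and w0: "\<And>x. x \<in> space M \<Longrightarrow> 0 \<le> w x" and wC: "\<And>x. x \<in> space M \<Longrightarrow> w x \<le> C"
  shows "f \<in> L2 (density M w)" and "L2norm (density M w) f \<le> sqrt C * L2norm M f"
proof -
  have [measurable]: "f \<in> borel_measurable M" and i: "integrable M (\<lambda>x. (norm (f x))\<^sup>2)"
    using f by (auto simp: L2_def)
  have iC: "integrable M (\<lambda>x. C * (norm (f x))\<^sup>2)"
    using i by simp
  have le: "w x * (norm (f x))\<^sup>2 \<le> C * (norm (f x))\<^sup>2" if "x \<in> space M" for x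
    using wC[OF that] by (simp add: mult_right_mono)
  have iw: "integrable M (\<lambda>x. w x * (norm (f x))\<^sup>2)"
  proof (rule Bochner_Integration.integrable_bound[OF iC])
    show "AE x in M. norm (w x * (norm (f x))\<^sup>2) \<le> norm (C * (norm (f x))\<^sup>2)"
    proof (rule AE_I2)
      fix x assume x: "x \<in> space M"
      show "norm (w x * (norm (f x))\<^sup>2) \<le> norm (C * (norm (f x))\<^sup>2)"
        using le[OF x] mult_nonneg_nonneg[OF w0[OF x] zero_le_power2[of "norm (f x)"]]
        unfolding real_norm_def by linarith
    qed
  qed simp
  then show "f \<in> L2 (density M w)"
    unfolding L2_def using w0 by (auto simp: integrable_density)
  have "(\<integral>x. (norm (f x))\<^sup>2 \<partial>density M w) = (\<integral>x. w x * (norm (f x))\<^sup>2 \<partial>M)"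
    using w0 by (subst integral_density) auto
  also have "\<dots> \<le> (\<integral>x. C * (norm (f x))\<^sup>2 \<partial>M)"
    by (intro integral_mono iw iC le)
  also have "\<dots> = C * (\<integral>x. (norm (f x))\<^sup>2 \<partial>M)"
    using i by simp
  finally show "L2norm (density M w) f \<le> sqrt C * L2norm M f"
    unfolding L2norm_def by (simp flip: real_sqrt_mult)
qed

lemma L2norm_density_tendsto_0:
  fixes w :: "'a \<Rightarrow> real"
  assumes "\<And>n. f n \<in> L2 M" "g \<in> L2 M" "w \<in> borel_measurable M"
    and "\<And>x. x \<in> space M \<Longrightarrow> 0 \<le> w x" "\<And>x. x \<in> space M \<Longrightarrow> w x \<le> C"
    and "(\<lambda>n. L2norm M (\<lambda>x. f n x - g x)) \<longlonglongrightarrow> 0"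
  shows "(\<lambda>n. L2norm (density M w) (\<lambda>x. f n x - g x)) \<longlonglongrightarrow> 0"
proof (rule Lim_null_comparison)
  show "\<forall>\<^sub>F n in sequentially. norm (L2norm (density M w) (\<lambda>x. f n x - g x))
      \<le> sqrt C * L2norm M (\<lambda>x. f n x - g x)"
    using L2_density_bounded(2)[OF L2_diff[OF assms(1,2)] assms(3-5)] by simp
  show "(\<lambda>n. sqrt C * L2norm M (\<lambda>x. f n x - g x)) \<longlonglongrightarrow> 0"
    using tendsto_mult_right_zero[OF assms(6)] by simp
qed

section \<open>Test functions\<close>

text \<open>Integration by parts without boundary terms: Fubini and the fundamental theorem of
  calculus on each line parallel to the first axis. It is applied to \<open>F\<close> equal to a
  weight times the squared modulus of a test function.\<close>

lemma integral_box_deriv_fst_eq_0: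
  fixes D F :: "real \<times> real \<Rightarrow> real"
  assumes "r \<ge> 0" and cont: "continuous_on (cbox (-r, -d) (r, d)) D"
    and deriv: "\<And>s t. \<lbrakk>\<bar>s\<bar> \<le> r; \<bar>t\<bar> \<le> d\<rbrakk> \<Longrightarrow> ((\<lambda>s. F (s, t)) has_real_derivative D (s, t)) (at s)"
    and bd: "\<And>t. F (r, t) = 0" "\<And>t. F (-r, t) = 0"
  shows "integral (cbox (-r, -d) (r, d)) D = 0"
proof -
  have inner: "integral (cbox (-r) r) (\<lambda>s. D (s, t)) = 0" if "\<bar>t\<bar> \<le> d" for t
  proof -
    have "((\<lambda>s. D (s, t)) has_integral (F (r, t) - F (-r, t))) {-r..r}"
    proof (rule fundamental_theorem_of_calculus)
      fix s assume "s \<in> {-r..r}"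
      then show "((\<lambda>s. F (s, t)) has_vector_derivative D (s, t)) (at s within {-r..r})"
        using deriv[of s t] that
        by (auto simp: has_real_derivative_iff_has_vector_derivative[symmetric]
            intro: has_field_derivative_at_within)
    qed (use assms(1) in auto)
    then show ?thesis
      using bd by (simp add: integral_unique)
  qed
  have "integral (cbox (-r, -d) (r, d)) D = integral (cbox (-r) r) (\<lambda>s. integral (cbox (-d) d) (\<lambda>t. D (s, t)))"
    by (rule integral_prod_continuous[OF cont])
  \<comment> \<open>The order of integration is exchanged so that the differentiated variable
    \<open>s\<close> becomes the inner one.\<close>
  also have "\<dots> = integral (cbox (-d) d) (\<lambda>t. integral (cbox (-r) r) (\<lambda>s. D (s, t)))"
    using integral_swap_continuous[of "-r" "-d" r d "\<lambda>s t. D (s, t)"] cont by simp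
  also have "\<dots> = integral (cbox (-d) d) (\<lambda>t. 0)"
    by (intro integral_cong inner) auto
  finally show ?thesis by simp
qed

lemma integral_box_deriv_snd_eq_0:
  fixes D F :: "real \<times> real \<Rightarrow> real"
  assumes "d \<ge> 0" and cont: "continuous_on (cbox (-r, -d) (r, d)) D"
    and deriv: "\<And>s t. \<lbrakk>\<bar>s\<bar> \<le> r; \<bar>t\<bar> \<le> d\<rbrakk> \<Longrightarrow> ((\<lambda>t. F (s, t)) has_real_derivative D (s, t)) (at t)"
    and bd: "\<And>s. F (s, d) = 0" "\<And>s. F (s, -d) = 0"
  shows "integral (cbox (-r, -d) (r, d)) D = 0"
proof -
  have inner: "integral (cbox (-d) d) (\<lambda>t. D (s, t)) = 0" if "\<bar>s\<bar> \<le> r" for s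
  proof -
    have "((\<lambda>t. D (s, t)) has_integral (F (s, d) - F (s, -d))) {-d..d}"
    proof (rule fundamental_theorem_of_calculus)
      fix t assume "t \<in> {-d..d}"
      then show "((\<lambda>t. F (s, t)) has_vector_derivative D (s, t)) (at t within {-d..d})"
        using deriv[of s t] that
        by (auto simp: has_real_derivative_iff_has_vector_derivative[symmetric]
            intro: has_field_derivative_at_within)
    qed (use assms(1) in auto)
    then show ?thesis
      using bd by (simp add: integral_unique)
  qed
  have "integral (cbox (-r, -d) (r, d)) D = integral (cbox (-r) r) (\<lambda>s. integral (cbox (-d) d) (\<lambda>t. D (s, t)))"
    by (rule integral_prod_continuous[OF cont])
  also have "\<dots> = integral (cbox (-r) r) (\<lambda>s. 0)"
    by (intro integral_cong inner) auto
  finally show ?thesis by simp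
qed

section \<open>Derivatives and supports of test functions\<close>

lemma test_functions_differentiable:
  assumes "\<phi> \<in> test_functions \<Omega>"
  shows "(\<phi> has_derivative frechet_derivative \<phi> (at x)) (at x)"
proof -
  have "C_k 1 \<phi>" using assms by (auto simp: test_functions_def simp del: C_k.simps)
  then show ?thesis
    by (auto simp: differentiable_on_def frechet_derivative_works)
qed

lemma test_functions_continuous:
  assumes "\<phi> \<in> test_functions \<Omega>"
  shows "continuous_on UNIV \<phi>" and "continuous_on UNIV (dir_deriv v \<phi>)"
proof -
  have "C_k 0 \<phi>" "C_k 1 \<phi>" using assms by (auto simp: test_functions_def simp del: C_k.simps)
  then show "continuous_on UNIV \<phi>" "continuous_on UNIV (dir_deriv v \<phi>)" by auto
qed

lemma dir_deriv_diff:
  assumes "f \<in> test_functions \<Omega>" "g \<in> test_functions \<Omega>"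
  shows "dir_deriv v (\<lambda>x. f x - g x) = (\<lambda>x. dir_deriv v f x - dir_deriv v g x)"
proof
  fix x
  have "((\<lambda>x. f x - g x) has_derivative
      (\<lambda>v. frechet_derivative f (at x) v - frechet_derivative g (at x) v)) (at x)"
    using assms by (intro has_derivative_diff) (auto intro: test_functions_differentiable)
  from frechet_derivative_at[OF this]
  show "dir_deriv v (\<lambda>x. f x - g x) x = dir_deriv v f x - dir_deriv v g x"
    unfolding dir_deriv_def by metis
qed

text \<open>The chain rule along the line through \<open>(s, t)\<close> turns the Frechet derivative
  into a partial one. The inner product is the real one on the complex plane, so cross terms are
  real and fit \<open>completing_square\<close>.\<close>

lemma has_real_derivative_norm2_fst:
  assumes "\<phi> \<in> test_functions \<Omega>"
  shows "((\<lambda>s. (norm (\<phi> (s, t)))\<^sup>2) has_real_derivative 2 * (\<phi> (s, t) \<bullet> partial1 \<phi> (s, t))) (at s)"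
proof -
  have "((\<lambda>s. (s, t)) has_derivative (\<lambda>u. (u, 0))) (at s)"
    by (auto intro!: derivative_eq_intros)
  from diff_chain_at[OF this test_functions_differentiable[OF assms]]
  have "((\<lambda>s. \<phi> (s, t)) has_derivative (\<lambda>u. frechet_derivative \<phi> (at (s, t)) (u, 0))) (at s)"
    by (simp add: o_def)
  moreover have "frechet_derivative \<phi> (at (s, t)) (u, 0) = u *\<^sub>R partial1 \<phi> (s, t)" for u
    using linear_scale[OF has_derivative_linear[OF test_functions_differentiable[OF assms, of "(s, t)"]], of u "(1, 0)"]
    by (simp add: dir_deriv_def)
  ultimately have d: "((\<lambda>s. \<phi> (s, t)) has_derivative (\<lambda>u. u *\<^sub>R partial1 \<phi> (s, t))) (at s)"
    by simp
  show ?thesis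
    unfolding power2_norm_eq_inner has_field_derivative_def
    by (rule has_derivative_eq_rhs[OF has_derivative_inner[OF d d]])
      (auto simp: inner_commute algebra_simps)
qed

lemma has_real_derivative_norm2_snd:
  assumes "\<phi> \<in> test_functions \<Omega>"
  shows "((\<lambda>t. (norm (\<phi> (s, t)))\<^sup>2) has_real_derivative 2 * (\<phi> (s, t) \<bullet> partial2 \<phi> (s, t))) (at t)"
proof -
  have "((\<lambda>t. (s, t)) has_derivative (\<lambda>u. (0, u))) (at t)"
    by (auto intro!: derivative_eq_intros)
  from diff_chain_at[OF this test_functions_differentiable[OF assms]]
  have "((\<lambda>t. \<phi> (s, t)) has_derivative (\<lambda>u. frechet_derivative \<phi> (at (s, t)) (0, u))) (at t)"
    by (simp add: o_def)
  moreover have "frechet_derivative \<phi> (at (s, t)) (0, u) = u *\<^sub>R partial2 \<phi> (s, t)" for u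
    using linear_scale[OF has_derivative_linear[OF test_functions_differentiable[OF assms, of "(s, t)"]], of u "(0, 1)"]
    by (simp add: dir_deriv_def)
  ultimately have d: "((\<lambda>t. \<phi> (s, t)) has_derivative (\<lambda>u. u *\<^sub>R partial2 \<phi> (s, t))) (at t)"
    by simp
  show ?thesis
    unfolding power2_norm_eq_inner has_field_derivative_def
    by (rule has_derivative_eq_rhs[OF has_derivative_inner[OF d d]])
      (auto simp: inner_commute algebra_simps)
qed

text \<open>A compact support inside the open strip keeps a positive distance from its boundary. The
  strict \<open>d < a\<close> is what later keeps the tangent bounded, and vanishing already on the
  lines where equality holds removes the boundary terms on the box.\<close>

lemma test_functions_strip_support:
  assumes "\<phi> \<in> test_functions (strip a)" "a > 0"
  obtains r d where "r > 0" "0 < d" "d < a"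
    "\<And>s t. \<lbrakk>\<bar>s\<bar> \<ge> r \<or> \<bar>t\<bar> \<ge> d\<rbrakk> \<Longrightarrow> \<phi> (s, t) = 0"
    "\<And>v s t. \<lbrakk>\<bar>s\<bar> \<ge> r \<or> \<bar>t\<bar> \<ge> d\<rbrakk> \<Longrightarrow> dir_deriv v \<phi> (s, t) = 0"
proof -
  define K where "K = closure {x. \<phi> x \<noteq> 0}"
  have K: "compact K" "K \<subseteq> strip a"
    using assms(1) by (auto simp: test_functions_def K_def)
  have "\<exists>r>0. \<forall>x\<in>K. \<bar>fst x\<bar> < r"
  proof -
    from compact_imp_bounded[OF K(1)] obtain r where r: "\<And>x. x \<in> K \<Longrightarrow> norm x \<le> r"
      by (auto simp: bounded_iff)
    have "\<bar>fst x\<bar> < \<bar>r\<bar> + 1" if "x \<in> K" for x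
      using r[OF that] norm_fst_le[of "fst x" "snd x"] by auto
    then show ?thesis by (intro exI[of _ "\<bar>r\<bar> + 1"]) auto
  qed
  then obtain r where r: "r > 0" "\<And>x. x \<in> K \<Longrightarrow> \<bar>fst x\<bar> < r" by blast
  have "\<exists>d>0. d < a \<and> (\<forall>x\<in>K. \<bar>snd x\<bar> < d)"
  proof (cases "K = {}")
    case True
    then show ?thesis using assms(2) by (intro exI[of _ "a / 2"]) auto
  next
    case False
    have "continuous_on K (\<lambda>x. \<bar>snd x\<bar>)" by (intro continuous_intros)
    from continuous_attains_sup[OF K(1) False this]
    obtain z where z: "z \<in> K" "\<And>x. x \<in> K \<Longrightarrow> \<bar>snd x\<bar> \<le> \<bar>snd z\<bar>" by auto
    have "\<bar>snd z\<bar> < a" using subsetD[OF K(2) z(1)] by (auto simp: strip_def)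
    then show ?thesis
      using z(2) by (intro exI[of _ "(\<bar>snd z\<bar> + a) / 2"]) force
  qed
  then obtain d where d: "0 < d" "d < a" "\<And>x. x \<in> K \<Longrightarrow> \<bar>snd x\<bar> < d" by blast
  have out: "(s, t) \<in> - K" if "\<bar>s\<bar> \<ge> r \<or> \<bar>t\<bar> \<ge> d" for s t
    using r(2)[of "(s, t)"] d(3)[of "(s, t)"] that by auto
  have zero: "\<phi> x = 0" if "x \<in> - K" for x
    using that closure_subset[of "{x. \<phi> x \<noteq> 0}"] unfolding K_def by blast
  have "dir_deriv v \<phi> x = 0" if "x \<in> - K" for v x
  proof -
    \<comment> \<open>Off the closed support \<open>\<phi>\<close> vanishes on a whole
      neighbourhood, hence so does its derivative.\<close>
    have "open (- K)" by (simp add: K_def open_Compl)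
    then have "(\<phi> has_derivative (\<lambda>_. 0)) (at x)"
      by (rule has_derivative_transform_within_open[OF has_derivative_const[of 0]])
        (use that zero in auto)
    from frechet_derivative_at[OF this] show ?thesis
      unfolding dir_deriv_def by metis
  qed
  with out zero show ?thesis
    by (intro that[OF r(1) d(1,2)]) auto
qed

section \<open>Riccati equations and weights\<close>

text \<open>Here \<open>q = h \<cdot> (ln (cos (\<kappa>t) / \<surd>h))'\<close>.\<close>

lemma riccati_transverse:
  fixes k t \<kappa> :: real
  defines "h \<equiv> \<lambda>t. sqrt (1 + t\<^sup>2 * k\<^sup>2)"
  defines "q \<equiv> \<lambda>t. - (\<kappa> * h t * tan (\<kappa> * t)) - k\<^sup>2 * t / (2 * h t)"
  assumes "cos (\<kappa> * t) \<noteq> 0"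
  shows "(q has_real_derivative
    - (\<kappa>\<^sup>2 * h t) - k\<^sup>2 * (2 - k\<^sup>2 * t\<^sup>2) / (4 * h t ^ 3) - (q t)\<^sup>2 / h t) (at t)"
proof -
  have pos: "1 + t\<^sup>2 * k\<^sup>2 > 0" for t :: real
    by (simp add: add_pos_nonneg)
  have h0: "h t > 0" for t
    unfolding h_def using pos by simp
  have h2: "(h t)\<^sup>2 = 1 + t\<^sup>2 * k\<^sup>2"
    unfolding h_def using pos[of t] by simp
  have dh: "(h has_real_derivative k\<^sup>2 * t / h t) (at t)"
    unfolding h_def using pos[of t]
    by (auto intro!: derivative_eq_intros simp: divide_simps)
  define tn where "tn = (\<lambda>t. tan (\<kappa> * t))"
  define T where "T = tn t"
  have dT: "(tn has_real_derivative \<kappa> * (1 + T\<^sup>2)) (at t)"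
    using DERIV_chain2[OF DERIV_tan[OF assms(3)] DERIV_cmult_Id[of \<kappa>]] tan_sec[OF assms(3)]
    by (simp add: T_def tn_def power_inverse mult.commute)
  have q: "q = (\<lambda>t. - (\<kappa> * h t * tn t) - k\<^sup>2 * t / (2 * h t))"
    by (simp add: q_def tn_def)
  have h3: "k\<^sup>2 / (2 * h t) - k\<^sup>2 * t * (k\<^sup>2 * t / h t) / (2 * (h t)\<^sup>2) = k\<^sup>2 / (2 * h t ^ 3)"
  \<comment> \<open>The quotient rule collapses because
    \<open>(h t)\<^sup>2 - k\<^sup>2 * t\<^sup>2 = 1\<close>.\<close>
  proof -
    have "k\<^sup>2 / (2 * h t) - k\<^sup>2 * t * (k\<^sup>2 * t / h t) / (2 * (h t)\<^sup>2)
        = k\<^sup>2 * ((h t)\<^sup>2 - k\<^sup>2 * t\<^sup>2) / (2 * h t ^ 3)"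
      using h0[of t] by (simp add: field_simps power2_eq_square power3_eq_cube)
    then show ?thesis by (simp add: h2 mult.commute)
  qed
  have "(q has_real_derivative
     - (\<kappa> * (k\<^sup>2 * t / h t) * T) - \<kappa> * h t * (\<kappa> * (1 + T\<^sup>2))
     - (k\<^sup>2 / (2 * h t) - k\<^sup>2 * t * (k\<^sup>2 * t / h t) / (2 * (h t)\<^sup>2))) (at t)"
    unfolding q using h0[of t]
    by (auto intro!: derivative_eq_intros dh dT simp: T_def field_simps power2_eq_square)
  \<comment> \<open>In \<open>(q t)\<^sup>2 / h t\<close> the mixed term cancels the derivative of
    \<open>h\<close>, the tangent term cancels \<open>T\<^sup>2\<close>, and the remaining square
    produces the \<open>- k\<^sup>2 * t\<^sup>2\<close> inside the potential.\<close>
  moreover have "- (\<kappa> * (k\<^sup>2 * t / h t) * T) - \<kappa> * h t * (\<kappa> * (1 + T\<^sup>2)) - k\<^sup>2 / (2 * h t ^ 3)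
     = - (\<kappa>\<^sup>2 * h t) - k\<^sup>2 * (2 - k\<^sup>2 * t\<^sup>2) / (4 * h t ^ 3) - (q t)\<^sup>2 / h t"
    unfolding q T_def[symmetric] using h0[of t]
    by (simp add: field_simps power2_eq_square power3_eq_cube)
  ultimately show ?thesis
    unfolding h3 by simp
qed

text \<open>The function is the logarithmic derivative of the fourth root of
  \<open>x\<^sup>2 + \<beta>\<^sup>2\<close>, a smoothed version of the square root of
  \<open>\<bar>x\<bar>\<close> that underlies the classical Hardy weight
  \<open>1 / (4 * x\<^sup>2)\<close>. Smoothing avoids a Dirichlet condition at the origin, at the
  price of a weight that is negative for small \<open>x\<close>.\<close>

lemma riccati_hardy:
  fixes \<beta> x :: real
  assumes "\<beta> > 0"
  shows "((\<lambda>x. x / (2 * (x\<^sup>2 + \<beta>\<^sup>2))) has_real_derivative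
    - ((x\<^sup>2 / 4 - \<beta>\<^sup>2 / 2) / (x\<^sup>2 + \<beta>\<^sup>2)\<^sup>2) - (x / (2 * (x\<^sup>2 + \<beta>\<^sup>2)))\<^sup>2) (at x)"
proof -
  have pos: "x\<^sup>2 + \<beta>\<^sup>2 > 0"
    using assms by (simp add: add_nonneg_pos)
  then have nz: "2 * (x * x) + 2 * (\<beta> * \<beta>) \<noteq> 0"
    by (simp add: power2_eq_square)
  define z where "z = x\<^sup>2 + \<beta>\<^sup>2"
  have "((\<lambda>x. x / (2 * (x\<^sup>2 + \<beta>\<^sup>2))) has_real_derivative (2 * z - x * (4 * x)) / (2 * z)\<^sup>2) (at x)"
    unfolding z_def using nz by (auto intro!: derivative_eq_intros simp: power2_eq_square)
  moreover have "(2 * z - x * (4 * x)) / (2 * z)\<^sup>2 =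
      - ((x\<^sup>2 / 4 - \<beta>\<^sup>2 / 2) / z\<^sup>2) - (x / (2 * z))\<^sup>2"
  proof -
    have \<beta>2: "\<beta>\<^sup>2 = z - x\<^sup>2" by (simp add: z_def)
    have "z \<noteq> 0" using pos unfolding z_def by linarith
    then show ?thesis
      unfolding \<beta>2 by (simp add: field_simps power2_eq_square)
  qed
  ultimately show ?thesis by (simp add: z_def)
qed

text \<open>Near \<open>s0\<close> continuity keeps \<open>w\<close> above a positive constant,
  which absorbs the negative part of the Hardy weight once \<open>\<epsilon>\<close> is small. Away
  from \<open>s0\<close> the Hardy weight alone decays no faster than a multiple of
  \<open>1 / (s - s0)\<^sup>2\<close>.\<close>

lemma hardy_weight_le:
  fixes w :: "real \<Rightarrow> real"
  assumes cont: "isCont w s0" and pos: "w s0 > 0" and nn: "\<And>s. w s \<ge> 0"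
  shows "\<exists>c>0. \<exists>\<beta>>0. \<exists>\<epsilon>. 0 \<le> \<epsilon> \<and> \<epsilon> \<le> 1 \<and>
    (\<forall>s. 2 * c / (1 + (s - s0)\<^sup>2)
      \<le> w s + \<epsilon> / 2 * (((s - s0)\<^sup>2 / 4 - \<beta>\<^sup>2 / 2) / ((s - s0)\<^sup>2 + \<beta>\<^sup>2)\<^sup>2))"
proof -
  define l where "l = w s0 / 2"
  have l: "l > 0" using pos by (simp add: l_def)
  have "\<forall>\<^sub>F s in at s0. w s > l"
    using cont pos unfolding isCont_def l_def by (intro order_tendstoD(1)) auto
  then obtain b where b: "b > 0" "\<And>s. s \<noteq> s0 \<Longrightarrow> dist s s0 < b \<Longrightarrow> w s > l"
    by (auto simp: eventually_at)
  have lb: "w s \<ge> l" if "\<bar>s - s0\<bar> < b" for s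
    using b(2)[of s] that pos by (cases "s = s0") (auto simp: dist_real_def l_def)
  \<comment> \<open>Half the radius, so that \<open>\<bar>x\<bar> \<ge> b\<close> forces
    \<open>x\<^sup>2 \<ge> 4 * \<beta>\<^sup>2\<close>, well inside the region of positive Hardy
    weight.\<close>
  define \<beta> where "\<beta> = b / 2"
  have \<beta>: "\<beta> > 0" using b by (simp add: \<beta>_def)
  \<comment> \<open>The second bound makes the worst loss
    \<open>\<epsilon> / 2 * (1 / (2 * \<beta>\<^sup>2))\<close> at most \<open>l / 2\<close>; the
    bound 1 is needed to compare \<open>\<epsilon> / 2\<close> with \<open>1 / h\<close>.\<close>
  define \<epsilon> where "\<epsilon> = min 1 (2 * l * \<beta>\<^sup>2)"
  have \<epsilon>: "0 < \<epsilon>" "\<epsilon> \<le> 1" "\<epsilon> \<le> 2 * l * \<beta>\<^sup>2"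
    using l \<beta> by (auto simp: \<epsilon>_def)
  \<comment> \<open>The two bounds on \<open>2 * c\<close> are the half of \<open>l\<close> left
    near \<open>s0\<close> and the coefficient \<open>\<epsilon> / 25\<close> obtained far from
    it.\<close>
  define c where "c = min (l / 4) (\<epsilon> / 50)"
  have c: "c > 0" "c \<le> l / 4" "c \<le> \<epsilon> / 50"
    using l \<epsilon>(1) by (auto simp: c_def)
  have "2 * c / (1 + (s - s0)\<^sup>2)
      \<le> w s + \<epsilon> / 2 * (((s - s0)\<^sup>2 / 4 - \<beta>\<^sup>2 / 2) / ((s - s0)\<^sup>2 + \<beta>\<^sup>2)\<^sup>2)" for s
  proof -
    define x where "x = s - s0"
    define W where "W = (x\<^sup>2 / 4 - \<beta>\<^sup>2 / 2) / (x\<^sup>2 + \<beta>\<^sup>2)\<^sup>2"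
    have x1: "1 + x\<^sup>2 > 0" by (simp add: add_pos_nonneg)
    have xb: "x\<^sup>2 + \<beta>\<^sup>2 > 0" using \<beta> by (simp add: add_nonneg_pos)
    show ?thesis
    proof (cases "\<bar>x\<bar> < b")
      case True
      \<comment> \<open>Lower bound for \<open>W\<close>: the term \<open>x\<^sup>2 / 4\<close> is
        dropped and the denominator is replaced by its smallest value.\<close>
      have "- (1 / (2 * \<beta>\<^sup>2)) = - (\<beta>\<^sup>2 / 2) / (\<beta>\<^sup>2)\<^sup>2"
        using \<beta> by (simp add: field_simps power2_eq_square)
      also have "\<dots> \<le> - (\<beta>\<^sup>2 / 2) / (x\<^sup>2 + \<beta>\<^sup>2)\<^sup>2"
        using \<beta> xb by (intro divide_left_mono_neg power_mono) auto
      also have "\<dots> \<le> W"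
        unfolding W_def by (intro divide_right_mono) auto
      finally have W: "- (1 / (2 * \<beta>\<^sup>2)) \<le> W" .
      have "- (l / 2) \<le> \<epsilon> / 2 * - (1 / (2 * \<beta>\<^sup>2))"
        using \<epsilon>(3) \<beta> by (simp add: field_simps)
      also have "\<dots> \<le> \<epsilon> / 2 * W"
        using W \<epsilon>(1) by (intro mult_left_mono) auto
      finally have 1: "- (l / 2) \<le> \<epsilon> / 2 * W" .
      have "2 * c / (1 + x\<^sup>2) \<le> 2 * c"
        using x1 c(1) by (simp add: divide_le_eq mult_left_mono)
      also have "\<dots> \<le> l / 2" using c(2) by simp
      finally show ?thesis
        using 1 lb[of s] True unfolding W_def x_def by linarith
    next
      case False
      then have "b\<^sup>2 \<le> x\<^sup>2" using b(1) by (intro abs_le_square_iff[THEN iffD1]) auto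
      then have x4: "4 * \<beta>\<^sup>2 \<le> x\<^sup>2" by (simp add: \<beta>_def power2_eq_square)
      have x0: "x\<^sup>2 > 0" using x4 \<beta> by (smt (verit) zero_less_power)
      have "2 * c / (1 + x\<^sup>2) \<le> \<epsilon> / 25 / x\<^sup>2"
        using c(1,3) x0 \<epsilon>(1) by (intro frac_le) auto
      \<comment> \<open>From \<open>\<beta>\<^sup>2 \<le> x\<^sup>2 / 4\<close> the numerator of
        \<open>W\<close> is at least \<open>x\<^sup>2 / 8\<close> and its denominator at most the
        square of \<open>5 / 4 * x\<^sup>2\<close>.\<close>
      also have "\<dots> = \<epsilon> / 2 * ((x\<^sup>2 / 8) / (5 / 4 * x\<^sup>2)\<^sup>2)"
        using x0 by (simp add: field_simps power2_eq_square)
      also have "\<dots> \<le> \<epsilon> / 2 * W"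
        unfolding W_def using \<epsilon>(1) x4 x0 xb
        by (intro mult_left_mono frac_le power_mono) auto
      finally show ?thesis
        using nn[of s] unfolding W_def x_def by linarith
    qed
  qed
  with c(1) \<beta> \<epsilon> show ?thesis
    by (intro exI[of _ c] conjI exI[of _ \<beta>] exI[of _ \<epsilon>]) auto
qed

section \<open>The inequality on test functions\<close>

text \<open>Expand the square of the norm of \<open>v - g *\<^sub>R u\<close>. Equality holds when
  \<open>v = g *\<^sub>R u\<close>, which is why \<open>g\<close> is chosen as a logarithmic
  derivative.\<close>

lemma completing_square:
  fixes u v :: "'b::real_inner"
  shows "2 * g * (u \<bullet> v) - g\<^sup>2 * (norm u)\<^sup>2 \<le> (norm v)\<^sup>2"
proof -
  have "0 \<le> (norm (v - g *\<^sub>R u))\<^sup>2" by simp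
  also have "\<dots> = (norm v)\<^sup>2 - 2 * g * (u \<bullet> v) + g\<^sup>2 * (norm u)\<^sup>2"
    unfolding power2_norm_eq_inner
    by (simp add: inner_diff_left inner_diff_right inner_commute power2_eq_square algebra_simps)
  finally show ?thesis by simp
qed

definition strip_h :: "(real \<Rightarrow> real) \<Rightarrow> real \<times> real \<Rightarrow> real" where
  "strip_h k = (\<lambda>x. sqrt (1 + (snd x)\<^sup>2 * (k (fst x))\<^sup>2))"

lemma strip_h_ge_1: "1 \<le> strip_h k x"
  by (simp add: strip_h_def)

lemma continuous_on_strip_h:
  assumes "continuous_on UNIV k"
  shows "continuous_on S (strip_h k)"
proof -
  have [continuous_intros]: "continuous_on S (\<lambda>x. k (fst x))" for S :: "(real \<times> real) set"
    by (rule continuous_on_compose2[OF assms]) (auto intro: continuous_intros)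
  show ?thesis
    unfolding strip_h_def by (intro continuous_intros)
qed

section \<open>Lebesgue and gauge integrals on the strip\<close>

lemma sets_strip: "strip a \<in> sets lebesgue"
proof -
  have "open (strip a)" unfolding strip_def by (intro open_Times) auto
  then show ?thesis by (simp add: borel_open)
qed

text \<open>Bridge to the gauge integral over a box, where the fundamental theorem of calculus and
  iterated integration apply. Continuity on the box suffices because \<open>f\<close> vanishes
  outside it.\<close>

lemma integral_lebesgue_on_continuous_support:
  fixes f :: "'a::euclidean_space \<Rightarrow> real"
  assumes "continuous_on (cbox a b) f" "\<And>x. x \<notin> cbox a b \<Longrightarrow> f x = 0"
    and "cbox a b \<subseteq> S" "S \<in> sets lebesgue"
  shows "integrable (lebesgue_on S) f"
    and "(\<integral>x. f x \<partial>lebesgue_on S) = integral (cbox a b) f"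
proof -
  have "f absolutely_integrable_on cbox a b"
    by (rule absolutely_integrable_continuous[OF assms(1)])
  then have "f absolutely_integrable_on S"
    unfolding absolutely_integrable_on_def
    using assms(2,3) by (auto intro: integrable_on_superset)
  then show i: "integrable (lebesgue_on S) f"
    by (rule absolutely_integrable_imp_integrable[OF _ assms(4)])
  have "(f has_integral integral (cbox a b) f) S"
    using has_integral_on_superset[OF integrable_integral[OF integrable_continuous[OF assms(1)]]]
      assms(2,3) by blast
  then show "(\<integral>x. f x \<partial>lebesgue_on S) = integral (cbox a b) f"
    using lebesgue_integral_eq_integral[OF i assms(4)] by (simp add: integral_unique)
qed

lemma test_functions_L2:
  assumes \<phi>: "\<phi> \<in> test_functions (strip a)" and "a > 0"
  shows "\<phi> \<in> L2 (lebesgue_on (strip a))" and "dir_deriv v \<phi> \<in> L2 (lebesgue_on (strip a))"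
proof -
  obtain r d where rd: "r > 0" "0 < d" "d < a"
    and z1: "\<And>s t. \<lbrakk>\<bar>s\<bar> \<ge> r \<or> \<bar>t\<bar> \<ge> d\<rbrakk> \<Longrightarrow> \<phi> (s, t) = 0"
    and z2: "\<And>v s t. \<lbrakk>\<bar>s\<bar> \<ge> r \<or> \<bar>t\<bar> \<ge> d\<rbrakk> \<Longrightarrow> dir_deriv v \<phi> (s, t) = 0"
    using test_functions_strip_support[OF assms] by metis
  have sub: "cbox (-r, -d) (r, d) \<subseteq> strip a"
    using rd by (auto simp: strip_def)
  have L2: "f \<in> L2 (lebesgue_on (strip a))"
    if "continuous_on UNIV f" and z: "\<And>s t. \<lbrakk>\<bar>s\<bar> \<ge> r \<or> \<bar>t\<bar> \<ge> d\<rbrakk> \<Longrightarrow> f (s, t) = 0"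
    for f :: "real \<times> real \<Rightarrow> complex"
  proof -
    have "continuous_on (cbox (-r, -d) (r, d)) (\<lambda>x. (norm (f x))\<^sup>2)"
      using that(1) by (intro continuous_intros) (auto intro: continuous_on_subset)
    then have "integrable (lebesgue_on (strip a)) (\<lambda>x. (norm (f x))\<^sup>2)"
      by (rule integral_lebesgue_on_continuous_support(1)[OF _ _ sub sets_strip])
        (use z in \<open>force simp: not_le\<close>)
    moreover have "f \<in> borel_measurable (lebesgue_on (strip a))"
      by (rule continuous_imp_measurable_on_sets_lebesgue[OF _ sets_strip])
        (use that(1) in \<open>auto intro: continuous_on_subset\<close>)
    ultimately show ?thesis by (simp add: L2_def)
  qed
  show "\<phi> \<in> L2 (lebesgue_on (strip a))"
    using L2[OF test_functions_continuous(1)[OF \<phi>]] z1 by blast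
  show "dir_deriv v \<phi> \<in> L2 (lebesgue_on (strip a))"
    using L2[OF test_functions_continuous(2)[OF \<phi>]] z2 by blast
qed

text \<open>A pointwise inequality bounds the density of the form from below by derivatives
  \<open>D1\<close>, \<open>D2\<close> of functions vanishing on the boundary of a box, and
  integration removes these. The numerical factors in \<open>weight\<close> reflect
  \<open>h \<le> 2\<close>, which follows from \<open>L < 2\<close>.\<close>

lemma hardy_test_functions:
  fixes k :: "real \<Rightarrow> real"
  assumes \<phi>: "\<phi> \<in> test_functions (strip a)" and "a > 0" and k: "continuous_on UNIV k"
    and L: "L < 2" "\<And>s. a\<^sup>2 * (k s)\<^sup>2 \<le> L"
    and \<beta>: "\<beta> > 0" and \<epsilon>: "0 \<le> \<epsilon>" "\<epsilon> \<le> 1" and c: "c \<ge> 0"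
    and weight: "\<And>s. 2 * c / (1 + (s - s0)\<^sup>2)
      \<le> (k s)\<^sup>2 * (2 - L) / 32 + \<epsilon> / 2 * (((s - s0)\<^sup>2 / 4 - \<beta>\<^sup>2 / 2) / ((s - s0)\<^sup>2 + \<beta>\<^sup>2)\<^sup>2)"
  defines "h \<equiv> strip_h k"
  shows "c * (L2norm (strip_measure a h) (\<lambda>x. \<phi> x / of_real (rho s0 x)))\<^sup>2
    \<le> Q0_core a h \<phi> - E1 a * (L2norm (strip_measure a h) \<phi>)\<^sup>2"
proof -
  obtain r d where rd: "r > 0" "0 < d" "d < a"
    and z1: "\<And>s t. \<lbrakk>\<bar>s\<bar> \<ge> r \<or> \<bar>t\<bar> \<ge> d\<rbrakk> \<Longrightarrow> \<phi> (s, t) = 0"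
    and z2: "\<And>v s t. \<lbrakk>\<bar>s\<bar> \<ge> r \<or> \<bar>t\<bar> \<ge> d\<rbrakk> \<Longrightarrow> dir_deriv v \<phi> (s, t) = 0"
    using test_functions_strip_support[OF \<phi> \<open>a > 0\<close>] by metis
  define B where "B = cbox (-r, -d) (r, d)"
  define \<mu> where "\<mu> = lebesgue_on (strip a)"
  have sub: "B \<subseteq> strip a"
    using rd by (auto simp: strip_def B_def)
  have contk [continuous_intros]: "continuous_on S (\<lambda>x. k (fst x))" for S :: "(real \<times> real) set"
    by (rule continuous_on_compose2[OF k]) (auto intro: continuous_intros)
  have cont\<phi> [continuous_intros]: "continuous_on S \<phi>" for S
    using test_functions_continuous(1)[OF \<phi>] by (rule continuous_on_subset) auto
  have contd [continuous_intros]: "continuous_on S (dir_deriv v \<phi>)" for S v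
    using test_functions_continuous(2)[OF \<phi>] by (rule continuous_on_subset) auto
  have conth [continuous_intros]: "continuous_on S h" for S
    unfolding h_def by (rule continuous_on_strip_h[OF k])
  have h1: "1 \<le> h x" for x unfolding h_def by (rule strip_h_ge_1)
  have h0: "h x \<noteq> 0" "h x > 0" for x using h1[of x] by auto
  have rho1: "rho s0 x \<ge> 1" "(rho s0 x)\<^sup>2 = 1 + (fst x - s0)\<^sup>2" for x
    by (auto simp: rho_def case_prod_beta)
  have contrho [continuous_intros]: "continuous_on S (rho s0)" for S
    unfolding rho_def case_prod_beta by (intro continuous_intros)
  have rho0: "rho s0 x \<noteq> 0" for x using rho1(1)[of x] by auto
  have meas: "f \<in> borel_measurable \<mu>" if "continuous_on UNIV f"
    for f :: "real \<times> real \<Rightarrow> 'b::euclidean_space"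
    unfolding \<mu>_def
    by (rule continuous_imp_measurable_on_sets_lebesgue[OF _ sets_strip])
      (use that in \<open>auto intro: continuous_on_subset\<close>)
  have norm_eq: "(L2norm (strip_measure a h) f)\<^sup>2 = integral B (\<lambda>x. h x * (norm (f x))\<^sup>2)"
    if f: "continuous_on UNIV f" and z: "\<And>s t. \<lbrakk>\<bar>s\<bar> \<ge> r \<or> \<bar>t\<bar> \<ge> d\<rbrakk> \<Longrightarrow> f (s, t) = 0"
    for f :: "real \<times> real \<Rightarrow> complex"
  proof -
    have "(L2norm (strip_measure a h) f)\<^sup>2 = (\<integral>x. h x * (norm (f x))\<^sup>2 \<partial>\<mu>)"
      unfolding strip_measure_def \<mu>_def[symmetric]
      by (rule L2norm_density_power2[OF meas[OF f] meas[OF conth] less_imp_le[OF h0(2)]])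
    also have "\<dots> = integral B (\<lambda>x. h x * (norm (f x))\<^sup>2)"
      unfolding \<mu>_def B_def
    proof (rule integral_lebesgue_on_continuous_support(2)[OF _ _ sub[unfolded B_def] sets_strip])
      show "continuous_on (cbox (- r, - d) (r, d)) (\<lambda>x. h x * (cmod (f x))\<^sup>2)"
        using f by (intro continuous_intros) (auto intro: continuous_on_subset)
      show "h x * (cmod (f x))\<^sup>2 = 0" if "x \<notin> cbox (- r, - d) (r, d)" for x
        using that z[of "fst x" "snd x"] by (cases x) (force simp: not_le)
    qed
    finally show ?thesis .
  qed
  define N where "N = (\<lambda>x. (norm (\<phi> x))\<^sup>2)"
  \<comment> \<open>\<open>cos (\<kappa> * t)\<close> is the ground state of the Dirichlet Laplacian
    in the interval, so \<open>\<kappa>\<^sup>2 = E1 a\<close>.\<close>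
  define \<kappa> where "\<kappa> = pi / (2 * a)"
  define q where "q = (\<lambda>x. - (\<kappa> * h x * tan (\<kappa> * snd x)) - (k (fst x))\<^sup>2 * snd x / (2 * h x))"
  \<comment> \<open>The derivative of \<open>q\<close> in \<open>t\<close>, written in the form
    supplied by \<open>riccati_transverse\<close>.\<close>
  define q' where "q' = (\<lambda>x. - (\<kappa>\<^sup>2 * h x)
    - (k (fst x))\<^sup>2 * (2 - (k (fst x))\<^sup>2 * (snd x)\<^sup>2) / (4 * h x ^ 3) - (q x)\<^sup>2 / h x)"
  define g where "g = (\<lambda>x::real \<times> real. (fst x - s0) / (2 * ((fst x - s0)\<^sup>2 + \<beta>\<^sup>2)))"
  define W where "W = (\<lambda>x::real \<times> real. ((fst x - s0)\<^sup>2 / 4 - \<beta>\<^sup>2 / 2) / ((fst x - s0)\<^sup>2 + \<beta>\<^sup>2)\<^sup>2)"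
  \<comment> \<open>\<open>D1\<close> and \<open>D2\<close> are the derivatives of
    \<open>g * N\<close> in \<open>s\<close> and of \<open>q * N\<close> in \<open>t\<close>, with
    those of \<open>g\<close> and \<open>q\<close> replaced by their Riccati expressions.\<close>
  define D1 where "D1 = (\<lambda>x. (- W x - (g x)\<^sup>2) * N x + 2 * (\<phi> x \<bullet> partial1 \<phi> x) * g x)"
  define D2 where "D2 = (\<lambda>x. q' x * N x + 2 * (\<phi> x \<bullet> partial2 \<phi> x) * q x)"
  have g0: "(fst x - s0)\<^sup>2 + \<beta>\<^sup>2 \<noteq> 0" for x :: "real \<times> real"
    using \<beta> by (smt (verit) zero_le_power2 zero_less_power)
  then have g1: "2 * (fst x - s0)\<^sup>2 + 2 * \<beta>\<^sup>2 \<noteq> 0" for x :: "real \<times> real"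
    by (metis distrib_left mult_eq_0_iff zero_neq_numeral)
  have cos0: "cos (\<kappa> * t) \<noteq> 0" if "\<bar>t\<bar> \<le> d" for t
  proof -
    have "\<kappa> > 0" using \<open>a > 0\<close> by (simp add: \<kappa>_def)
    then have "\<bar>\<kappa> * t\<bar> < \<kappa> * a" using that rd by (simp add: abs_mult)
    also have "\<kappa> * a = pi / 2" using \<open>a > 0\<close> by (simp add: \<kappa>_def)
    finally have "- (pi / 2) < \<kappa> * t" "\<kappa> * t < pi / 2" by auto
    then show ?thesis using cos_gt_zero_pi by force
  qed
  have cosB: "cos (\<kappa> * snd x) \<noteq> 0" if "x \<in> B" for x
    using that by (intro cos0; cases x) (auto simp: B_def)
  have contg [continuous_intros]: "continuous_on B g"
    unfolding g_def by (intro continuous_intros) (use g1 in \<open>auto simp: distrib_left\<close>)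
  have contW [continuous_intros]: "continuous_on B W"
    unfolding W_def by (intro continuous_intros) (use g0 in auto)
  have [continuous_intros]: "continuous_on B (\<lambda>x. tan (\<kappa> * snd x))"
    unfolding tan_def by (intro continuous_intros) (use cosB in auto)
  have contq [continuous_intros]: "continuous_on B q"
    unfolding q_def by (intro continuous_intros) (use h0 cosB in auto)
  have contq' [continuous_intros]: "continuous_on B q'"
    unfolding q'_def by (intro continuous_intros) (use h0 in auto)
  have contN [continuous_intros]: "continuous_on B N"
    unfolding N_def by (intro continuous_intros)
  have contD1: "continuous_on B D1" and contD2: "continuous_on B D2"
    unfolding D1_def D2_def by (intro continuous_intros)+
  have int1: "integral B D1 = 0"
    unfolding B_def
  proof (rule integral_box_deriv_fst_eq_0[where F = "\<lambda>x. g x * N x"])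
    show "((\<lambda>s. g (s, t) * N (s, t)) has_real_derivative D1 (s, t)) (at s)" for s t
    proof -
      have "((\<lambda>s. g (s, t)) has_real_derivative - W (s, t) - (g (s, t))\<^sup>2) (at s)"
        using DERIV_shift[of _ _ "s" "- s0", THEN iffD1, OF riccati_hardy[OF \<beta>, of "s + - s0"]]
        by (simp add: g_def W_def)
      from DERIV_mult[OF this has_real_derivative_norm2_fst[OF \<phi>]]
      show ?thesis by (simp add: D1_def N_def)
    qed
  qed (use rd contD1 z1 in \<open>auto simp: B_def N_def\<close>)
  have int2: "integral B D2 = 0"
    unfolding B_def
  proof (rule integral_box_deriv_snd_eq_0[where F = "\<lambda>x. q x * N x"])
    show "((\<lambda>t. q (s, t) * N (s, t)) has_real_derivative D2 (s, t)) (at t)" if "\<bar>t\<bar> \<le> d" for s t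
    proof -
      have "((\<lambda>t. q (s, t)) has_real_derivative q' (s, t)) (at t)"
        using riccati_transverse[OF cos0[OF that], of "k s"]
        by (simp add: q_def q'_def h_def strip_h_def)
      from DERIV_mult[OF this has_real_derivative_norm2_snd[OF \<phi>]]
      show ?thesis by (simp add: D2_def N_def)
    qed
  qed (use rd contD2 z1 in \<open>auto simp: B_def N_def\<close>)
  have pointwise: "\<epsilon> / 2 * D1 x + D2 x \<le> h x * (norm (partial1 \<phi> x / of_real (h x)))\<^sup>2
      + h x * (norm (partial2 \<phi> x))\<^sup>2 - \<kappa>\<^sup>2 * (h x * N x)
      - c * (h x * (norm (\<phi> x / of_real (rho s0 x)))\<^sup>2)" if "x \<in> B" for x
  proof -
    have tk: "(k (fst x))\<^sup>2 * (snd x)\<^sup>2 \<le> L"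
    proof -
      have "\<bar>snd x\<bar> \<le> \<bar>a\<bar>" using that rd by (cases x) (auto simp: B_def)
      then have "(snd x)\<^sup>2 \<le> a\<^sup>2" by (simp add: abs_le_square_iff)
      then have "(k (fst x))\<^sup>2 * (snd x)\<^sup>2 \<le> (k (fst x))\<^sup>2 * a\<^sup>2"
        by (intro mult_left_mono) auto
      then show ?thesis using L(2)[of "fst x"] by (simp add: mult.commute)
    qed
    \<comment> \<open>Here \<open>(h x)\<^sup>2 = 1 + k\<^sup>2 * t\<^sup>2 < 3\<close>.\<close>
    have "(h x)\<^sup>2 \<le> 2\<^sup>2"
      using tk L(1) by (simp add: h_def strip_h_def mult.commute)
    then have h2: "h x \<le> 2" by (rule power2_le_imp_le) simp
    have h3: "h x ^ 3 \<le> 8" using power_mono[OF h2, of 3] h0(2)[of x] by simp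
    have N0: "N x \<ge> 0" by (simp add: N_def)
    let ?v = "partial1 \<phi> x" and ?z = "partial2 \<phi> x"
    have "\<epsilon> / 2 * (D1 x + W x * N x) = \<epsilon> / 2 * (2 * g x * (\<phi> x \<bullet> ?v) - (g x)\<^sup>2 * (norm (\<phi> x))\<^sup>2)"
      by (simp add: D1_def N_def algebra_simps)
    also have "\<dots> \<le> \<epsilon> / 2 * (norm ?v)\<^sup>2"
      using \<epsilon> by (intro mult_left_mono completing_square) auto
    \<comment> \<open>In the longitudinal direction \<open>1 / h\<close> is bounded below by the
      constant \<open>\<epsilon> / 2\<close> before any integration by parts: \<open>k\<close> is
      merely continuous, so \<open>h\<close> need not be differentiable in \<open>s\<close>.\<close>
    also have "\<dots> \<le> 1 / h x * (norm ?v)\<^sup>2"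
      using \<epsilon> h2 h0(2)[of x] by (intro mult_right_mono frac_le) auto
    also have "\<dots> = h x * (norm (?v / of_real (h x)))\<^sup>2"
      using h0(2)[of x] by (simp add: norm_divide field_simps power2_eq_square)
    finally have 1: "\<epsilon> / 2 * (D1 x + W x * N x) \<le> h x * (norm (?v / of_real (h x)))\<^sup>2" .
    \<comment> \<open>In the transverse direction \<open>h\<close> is differentiable and stays as a
      weight: the square is completed with \<open>q / h\<close>, and the factor \<open>h\<close>
      built into \<open>q\<close> accounts for the weight.\<close>
    have "D2 x - (q' x + (q x)\<^sup>2 / h x) * N x
        = h x * (2 * (q x / h x) * (\<phi> x \<bullet> ?z) - (q x / h x)\<^sup>2 * (norm (\<phi> x))\<^sup>2)"
      using h0(1)[of x] by (simp add: D2_def N_def field_simps power2_eq_square)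
    also have "\<dots> \<le> h x * (norm ?z)\<^sup>2"
      using h0(2)[of x] by (intro mult_left_mono completing_square) auto
    finally have 2: "D2 x - (q' x + (q x)\<^sup>2 / h x) * N x \<le> h x * (norm ?z)\<^sup>2" .
    \<comment> \<open>The 32 is 4 times the bound 8 on \<open>h x ^ 3\<close>.\<close>
    have "(k (fst x))\<^sup>2 * (2 - L) / 32
        \<le> (k (fst x))\<^sup>2 * (2 - (k (fst x))\<^sup>2 * (snd x)\<^sup>2) / (4 * h x ^ 3)"
      using tk L(1) h3 h0(2)[of x] by (intro frac_le mult_left_mono mult_nonneg_nonneg) auto
    then have "q' x + (q x)\<^sup>2 / h x + \<kappa>\<^sup>2 * h x \<le> - ((k (fst x))\<^sup>2 * (2 - L) / 32)"
      unfolding q'_def by linarith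
    also have "\<dots> \<le> \<epsilon> / 2 * W x - 2 * c / (1 + (fst x - s0)\<^sup>2)"
      using weight[of "fst x"] by (simp add: W_def)
    finally have "(q' x + (q x)\<^sup>2 / h x + \<kappa>\<^sup>2 * h x) * N x
        \<le> (\<epsilon> / 2 * W x - 2 * c / (1 + (fst x - s0)\<^sup>2)) * N x"
      using N0 by (rule mult_right_mono)
    then have 3: "(q' x + (q x)\<^sup>2 / h x) * N x + \<kappa>\<^sup>2 * (h x * N x)
        \<le> \<epsilon> / 2 * (W x * N x) - 2 * c / (1 + (fst x - s0)\<^sup>2) * N x"
      by (simp only: distrib_right left_diff_distrib mult.assoc)
    have 4: "\<epsilon> / 2 * D1 x + \<epsilon> / 2 * (W x * N x) \<le> h x * (norm (?v / of_real (h x)))\<^sup>2"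
      using 1 by (simp only: distrib_left)
    have "c * (h x * (norm (\<phi> x / of_real (rho s0 x)))\<^sup>2)
        \<le> 2 * c / (1 + (fst x - s0)\<^sup>2) * N x"
    proof -
      have "c * (h x * (norm (\<phi> x / of_real (rho s0 x)))\<^sup>2) = c * h x / (1 + (fst x - s0)\<^sup>2) * N x"
        by (simp add: norm_divide power_divide rho1(2) N_def)
      also have "\<dots> \<le> 2 * c / (1 + (fst x - s0)\<^sup>2) * N x"
        using c h2 N0 by (intro mult_right_mono divide_right_mono) (auto simp: mult.commute mult_left_mono)
      finally show ?thesis .
    qed
    with 2 3 4 show ?thesis
      by linarith
  qed
  have "0 = integral B (\<lambda>x. \<epsilon> / 2 * D1 x + D2 x)"
  proof -
    have "integral B (\<lambda>x. \<epsilon> / 2 * D1 x + D2 x) = integral B (\<lambda>x. \<epsilon> / 2 * D1 x) + integral B D2"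
      using contD1 contD2 unfolding B_def
      by (intro Henstock_Kurzweil_Integration.integral_add integrable_continuous continuous_intros)
    then show ?thesis using int1 int2 by simp
  qed
  also have "\<dots> \<le> integral B (\<lambda>x. h x * (norm (partial1 \<phi> x / of_real (h x)))\<^sup>2
      + h x * (norm (partial2 \<phi> x))\<^sup>2 - \<kappa>\<^sup>2 * (h x * N x)
      - c * (h x * (norm (\<phi> x / of_real (rho s0 x)))\<^sup>2))"
  proof (rule integral_le[OF _ _ pointwise])
    show "(\<lambda>x. \<epsilon> / 2 * D1 x + D2 x) integrable_on B"
      using contD1 contD2 unfolding B_def by (intro integrable_continuous continuous_intros)
    show "(\<lambda>x. h x * (norm (partial1 \<phi> x / of_real (h x)))\<^sup>2
      + h x * (norm (partial2 \<phi> x))\<^sup>2 - \<kappa>\<^sup>2 * (h x * N x)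
      - c * (h x * (norm (\<phi> x / of_real (rho s0 x)))\<^sup>2)) integrable_on B"
      using contN unfolding B_def
      by (intro integrable_continuous continuous_intros) (use h0 rho0 in auto)
  qed
  also have "\<dots> = integral B (\<lambda>x. h x * (norm (partial1 \<phi> x / of_real (h x)))\<^sup>2)
      + integral B (\<lambda>x. h x * (norm (partial2 \<phi> x))\<^sup>2) - \<kappa>\<^sup>2 * integral B (\<lambda>x. h x * N x)
      - c * integral B (\<lambda>x. h x * (norm (\<phi> x / of_real (rho s0 x)))\<^sup>2)"
  proof -
    have "(\<lambda>x. h x * (norm (partial1 \<phi> x / of_real (h x)))\<^sup>2) integrable_on B"
      "(\<lambda>x. h x * (norm (partial2 \<phi> x))\<^sup>2) integrable_on B"
      "(\<lambda>x. h x * N x) integrable_on B"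
      "(\<lambda>x. h x * (norm (\<phi> x / of_real (rho s0 x)))\<^sup>2) integrable_on B"
      using contN unfolding B_def
      by (intro integrable_continuous continuous_intros; use h0 rho0 in auto)+
    then show ?thesis
      by (intro integral_unique has_integral_add has_integral_diff has_integral_mult_right
          integrable_integral)
  qed
  also have "\<dots> = Q0_core a h \<phi> - E1 a * (L2norm (strip_measure a h) \<phi>)\<^sup>2
      - c * (L2norm (strip_measure a h) (\<lambda>x. \<phi> x / of_real (rho s0 x)))\<^sup>2"
  proof -
    have "(L2norm (strip_measure a h) (\<lambda>x. partial1 \<phi> x / of_real (h x)))\<^sup>2
        = integral B (\<lambda>x. h x * (norm (partial1 \<phi> x / of_real (h x)))\<^sup>2)"
      by (rule norm_eq) (use h0 z2 in \<open>auto intro!: continuous_intros\<close>)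
    moreover have "(L2norm (strip_measure a h) (partial2 \<phi>))\<^sup>2
        = integral B (\<lambda>x. h x * (norm (partial2 \<phi> x))\<^sup>2)"
      by (rule norm_eq) (use z2 in \<open>auto intro!: continuous_intros\<close>)
    moreover have "(L2norm (strip_measure a h) \<phi>)\<^sup>2 = integral B (\<lambda>x. h x * N x)"
      unfolding N_def by (rule norm_eq) (use z1 in \<open>auto intro!: continuous_intros\<close>)
    moreover have "(L2norm (strip_measure a h) (\<lambda>x. \<phi> x / of_real (rho s0 x)))\<^sup>2
        = integral B (\<lambda>x. h x * (norm (\<phi> x / of_real (rho s0 x)))\<^sup>2)"
      by (rule norm_eq) (use rho0 z1 in \<open>auto intro!: continuous_intros\<close>)
    moreover have "E1 a = \<kappa>\<^sup>2"
      by (simp add: E1_def \<kappa>_def power_divide)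
    ultimately show ?thesis by (simp add: Q0_core_def)
  qed
  finally show ?thesis by simp
qed

section \<open>Passage to the form domain\<close>

lemma strip_h_bounded_inverse:
  assumes "continuous_on UNIV k"
  shows "(\<lambda>x. 1 / of_real (strip_h k x) :: complex) \<in> borel_measurable (lebesgue_on (strip a))"
    and "norm (1 / of_real (strip_h k x) :: complex) \<le> 1"
proof -
  have nz: "strip_h k x \<noteq> 0" for x using strip_h_ge_1[of k x] by auto
  show "(\<lambda>x. 1 / of_real (strip_h k x) :: complex) \<in> borel_measurable (lebesgue_on (strip a))"
    by (rule continuous_imp_measurable_on_sets_lebesgue[OF _ sets_strip])
      (use nz in \<open>auto intro!: continuous_intros continuous_on_strip_h[OF assms]\<close>)
  show "norm (1 / of_real (strip_h k x) :: complex) \<le> 1"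
    using strip_h_ge_1[of k x] by (simp add: norm_divide)
qed

lemma rho_bounded_inverse:
  shows "(\<lambda>x. 1 / of_real (rho s0 x) :: complex) \<in> borel_measurable (lebesgue_on (strip a))"
    and "norm (1 / of_real (rho s0 x) :: complex) \<le> 1"
proof -
  have ge: "rho s0 x \<ge> 1" for x by (simp add: rho_def case_prod_beta)
  then have nz: "rho s0 x \<noteq> 0" for x by (metis not_one_le_zero)
  have "continuous_on S (rho s0)" for S
    unfolding rho_def case_prod_beta by (intro continuous_intros)
  then show "(\<lambda>x. 1 / of_real (rho s0 x) :: complex) \<in> borel_measurable (lebesgue_on (strip a))"
    by (intro continuous_imp_measurable_on_sets_lebesgue[OF _ sets_strip])
      (use nz in \<open>auto intro!: continuous_intros\<close>)
  show "norm (1 / of_real (rho s0 x) :: complex) \<le> 1"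
    using ge[of x] by (simp add: norm_divide)
qed

text \<open>The approximating sequence from \<open>W012\<close> also witnesses the form closure:
  since \<open>1 \<le> h \<le> C\<close> on the strip, convergence of the functions and of their
  partial derivatives survives the change of measure and division by \<open>h\<close>.\<close>

lemma W012_imp_form_closure_graph:
  fixes k :: "real \<Rightarrow> real"
  assumes "a > 0" and k: "continuous_on UNIV k"
    and h2: "\<And>x. x \<in> strip a \<Longrightarrow> strip_h k x \<le> C"
    and \<psi>: "\<psi> \<in> W012 (strip a)"
  shows "\<exists>l. form_closure_graph (strip_measure a (strip_h k)) (test_functions (strip a))
      (Q0_core a (strip_h k)) \<psi> l"
proof -
  define h where "h = strip_h k"
  define \<mu> where "\<mu> = lebesgue_on (strip a)"
  define M where "M = strip_measure a h"
  have M: "M = density \<mu> (\<lambda>x. ennreal (h x))"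
    by (simp add: M_def strip_measure_def \<mu>_def)
  have [measurable]: "h \<in> borel_measurable \<mu>"
    unfolding \<mu>_def h_def
    by (rule continuous_imp_measurable_on_sets_lebesgue[OF continuous_on_strip_h[OF k] sets_strip])
  have h0: "0 \<le> h x" and hC: "x \<in> space \<mu> \<Longrightarrow> h x \<le> C" for x
    using strip_h_ge_1[of k x] h2 by (auto simp: h_def \<mu>_def)
  obtain g1 g2 \<phi> where L2: "\<psi> \<in> L2 \<mu>" "g1 \<in> L2 \<mu>" "g2 \<in> L2 \<mu>"
    and \<phi>: "\<And>n. \<phi> n \<in> test_functions (strip a)"
    and lim: "(\<lambda>n. L2norm \<mu> (\<lambda>x. \<phi> n x - \<psi> x)) \<longlonglongrightarrow> 0"
      "(\<lambda>n. L2norm \<mu> (\<lambda>x. partial1 (\<phi> n) x - g1 x)) \<longlonglongrightarrow> 0"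
      "(\<lambda>n. L2norm \<mu> (\<lambda>x. partial2 (\<phi> n) x - g2 x)) \<longlonglongrightarrow> 0"
    using \<psi> unfolding W012_def \<mu>_def by blast
  have toM: "f \<in> L2 M" if "f \<in> L2 \<mu>" for f
    unfolding M by (rule L2_density_bounded(1)[OF that _ h0 hC]) auto
  have limM: "(\<lambda>n. L2norm M (\<lambda>x. f n x - g x)) \<longlonglongrightarrow> 0"
    if "\<And>n. f n \<in> L2 \<mu>" "g \<in> L2 \<mu>" "(\<lambda>n. L2norm \<mu> (\<lambda>x. f n x - g x)) \<longlonglongrightarrow> 0" for f g
    unfolding M by (rule L2norm_density_tendsto_0[OF that(1,2) _ h0 hC that(3)]) auto
  have \<phi>L2: "\<phi> n \<in> L2 \<mu>" "dir_deriv v (\<phi> n) \<in> L2 \<mu>" for n v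
    using test_functions_L2[OF \<phi> \<open>a > 0\<close>] by (auto simp: \<mu>_def)
  define u where "u = (\<lambda>x. 1 / of_real (h x) :: complex)"
  have u: "u \<in> borel_measurable M" "\<And>x. norm (u x) \<le> 1"
    using strip_h_bounded_inverse[OF k] by (simp_all add: u_def M \<mu>_def h_def)
  note f1 = toM[OF \<phi>L2(2)] toM[OF L2(2)]
  have F1: "(\<lambda>x. partial1 (\<phi> n) x * u x) \<in> L2 M" "(\<lambda>x. g1 x * u x) \<in> L2 M" for n
    using f1 by (auto intro!: L2_mult_bounded(1) u)
  have lim1: "(\<lambda>n. L2norm M (\<lambda>x. partial1 (\<phi> n) x * u x - g1 x * u x)) \<longlonglongrightarrow> 0"
    by (rule L2_tendsto_mult_bounded[OF f1 u limM[OF \<phi>L2(2) L2(2) lim(2)]])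
  note F2 = toM[OF \<phi>L2(2)] toM[OF L2(3)]
  note lim2 = limM[OF \<phi>L2(2) L2(3) lim(3)]
  have q: "Q0_core a h f = (L2norm M (\<lambda>x. partial1 f x * u x))\<^sup>2 + (L2norm M (partial2 f))\<^sup>2" for f
    by (simp add: Q0_core_def M_def u_def)
  \<comment> \<open>The limit is the formula for the form evaluated at the weak derivatives
    \<open>g1\<close> and \<open>g2\<close>.\<close>
  have "(\<lambda>n. Q0_core a h (\<phi> n)) \<longlonglongrightarrow> (L2norm M (\<lambda>x. g1 x * u x))\<^sup>2 + (L2norm M g2)\<^sup>2"
    unfolding q by (intro tendsto_intros L2norm_tendsto F1 F2 lim1 lim2)
  moreover have "\<exists>N. \<forall>m\<ge>N. \<forall>n\<ge>N. Q0_core a h (\<lambda>x. \<phi> m x - \<phi> n x) < e" if "e > 0" for e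
  proof -
    have e: "e / 2 > 0" using that by simp
    obtain N1 where N1: "\<And>m n. m \<ge> N1 \<Longrightarrow> n \<ge> N1 \<Longrightarrow>
        (L2norm M (\<lambda>x. partial1 (\<phi> m) x * u x - partial1 (\<phi> n) x * u x))\<^sup>2 < e / 2"
      using L2_Cauchy[OF F1 lim1 e] by blast
    obtain N2 where N2: "\<And>m n. m \<ge> N2 \<Longrightarrow> n \<ge> N2 \<Longrightarrow>
        (L2norm M (\<lambda>x. partial2 (\<phi> m) x - partial2 (\<phi> n) x))\<^sup>2 < e / 2"
      using L2_Cauchy[OF F2 lim2 e] by blast
    have "Q0_core a h (\<lambda>x. \<phi> m x - \<phi> n x) < e" if "m \<ge> max N1 N2" "n \<ge> max N1 N2" for m n
      using N1[of m n] N2[of m n] that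
      by (simp add: q dir_deriv_diff[OF \<phi> \<phi>] left_diff_distrib)
    then show ?thesis by blast
  qed
  ultimately show ?thesis
    unfolding form_closure_graph_def h_def[symmetric] M_def[symmetric]
    using toM[OF L2(1)] \<phi> limM[OF \<phi>L2(1) L2(1) lim(1)] by blast
qed

text \<open>Both norms are continuous along the approximating sequence and the form values tend to
  \<open>l\<close>, so the inequality passes to the limit. It holds for every \<open>l\<close> in
  the graph, in particular for the one picked by the choice operator in
  \<open>form_closure\<close>.\<close>

lemma form_closure_graph_lower_bound:
  fixes u :: "'a \<Rightarrow> complex"
  assumes graph: "form_closure_graph M D q \<psi> l"
    and D: "\<And>\<phi>. \<phi> \<in> D \<Longrightarrow> \<phi> \<in> L2 M"
    and u: "u \<in> borel_measurable M" "\<And>x. norm (u x) \<le> 1"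
    and bound: "\<And>\<phi>. \<phi> \<in> D \<Longrightarrow> c * (L2norm M (\<lambda>x. \<phi> x * u x))\<^sup>2 \<le> q \<phi> - E * (L2norm M \<phi>)\<^sup>2"
  shows "c * (L2norm M (\<lambda>x. \<psi> x * u x))\<^sup>2 \<le> l - E * (L2norm M \<psi>)\<^sup>2"
proof -
  obtain \<phi> where \<psi>: "\<psi> \<in> L2 M" and \<phi>: "\<And>n. \<phi> n \<in> D"
    and lim: "(\<lambda>n. L2norm M (\<lambda>x. \<phi> n x - \<psi> x)) \<longlonglongrightarrow> 0" "(\<lambda>n. q (\<phi> n)) \<longlonglongrightarrow> l"
    using graph unfolding form_closure_graph_def by blast
  have 1: "(\<lambda>n. L2norm M (\<phi> n)) \<longlonglongrightarrow> L2norm M \<psi>"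
    by (rule L2norm_tendsto[OF D[OF \<phi>] \<psi> lim(1)])
  have 2: "(\<lambda>n. L2norm M (\<lambda>x. \<phi> n x * u x)) \<longlonglongrightarrow> L2norm M (\<lambda>x. \<psi> x * u x)"
    by (rule L2norm_tendsto[OF L2_mult_bounded(1)[OF D[OF \<phi>] u] L2_mult_bounded(1)[OF \<psi> u]
        L2_tendsto_mult_bounded[OF D[OF \<phi>] \<psi> u lim(1)]])
  show ?thesis
    by (rule LIMSEQ_le[OF tendsto_mult[OF tendsto_const tendsto_power[OF 2]]
        tendsto_diff[OF lim(2) tendsto_mult[OF tendsto_const tendsto_power[OF 1]]]])
      (use bound[OF \<phi>] in auto)
qed

theorem theorem1:
  fixes a :: real and \<tau> \<theta> :: "real \<Rightarrow> real"
  assumes "a > 0"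
    and "bounded (range \<tau>)" and "continuous_on UNIV \<tau>"
    and "bounded (range \<theta>)" and "\<theta> differentiable_on UNIV"
    and "continuous_on UNIV (deriv \<theta>)" and "bounded (range (deriv \<theta>))"
    and "\<exists>s. \<tau> s - deriv \<theta> s \<noteq> 0"
    and "a * (SUP s. \<bar>\<tau> s - deriv \<theta> s\<bar>) < sqrt 2"
  shows "\<forall>s0. \<tau> s0 - deriv \<theta> s0 \<noteq> 0 \<longrightarrow>
    (\<exists>c>0. \<forall>\<psi>\<in>W012 (strip a).
       Q0 a (h0 \<tau> \<theta>) \<psi> - E1 a * (L2norm (strip_measure a (h0 \<tau> \<theta>)) \<psi>)\<^sup>2
         \<ge> c * (L2norm (strip_measure a (h0 \<tau> \<theta>)) (\<lambda>x. \<psi> x / of_real (rho s0 x)))\<^sup>2)"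
proof (intro allI impI)
  fix s0
  define k where "k = (\<lambda>s. \<tau> s - deriv \<theta> s)"
  assume "\<tau> s0 - deriv \<theta> s0 \<noteq> 0"
  then have k0: "k s0 \<noteq> 0" by (simp add: k_def)
  have h: "h0 \<tau> \<theta> = strip_h k"
    by (simp add: h0_def strip_h_def k_def fun_eq_iff)
  have k: "continuous_on UNIV k"
    unfolding k_def by (intro continuous_intros assms)
  define K where "K = (SUP s. \<bar>k s\<bar>)"
  \<comment> \<open>A real supremum is an upper bound only for a set bounded above; boundedness
    comes from that of \<open>\<tau>\<close> and \<open>deriv \<theta>\<close>.\<close>
  have bdd: "bdd_above (range (\<lambda>s. \<bar>k s\<bar>))"
  proof -
    have "bounded (range k)"
      using bounded_minus_comp[OF assms(2,7)] by (simp add: k_def)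
    then show ?thesis
      by (auto simp: bounded_iff bdd_above_def)
  qed
  have kK: "\<bar>k s\<bar> \<le> K" for s
    unfolding K_def by (rule cSUP_upper[OF UNIV_I bdd])
  then have K0: "K \<ge> 0" using abs_ge_zero order_trans by blast
  \<comment> \<open>The strict hypothesis leaves the margin \<open>2 - L > 0\<close>, uniform over
    the strip, which keeps the transverse potential above a positive multiple of
    \<open>k\<^sup>2\<close>.\<close>
  define L where "L = (a * K)\<^sup>2"
  have L2: "L < 2"
  proof -
    have "a * K < sqrt 2" using assms(9) by (simp add: K_def k_def)
    then have "(a * K)\<^sup>2 < (sqrt 2)\<^sup>2"
      using \<open>a > 0\<close> K0 by (intro power_strict_mono) auto
    then show ?thesis by (simp add: L_def)
  qed
  have kL: "a\<^sup>2 * (k s)\<^sup>2 \<le> L" for s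
  proof -
    have "(k s)\<^sup>2 \<le> K\<^sup>2" using kK[of s] K0 by (simp add: abs_le_square_iff[symmetric])
    then show ?thesis by (simp add: L_def power_mult_distrib mult_left_mono)
  qed
  have h2: "strip_h k x \<le> 2" if "x \<in> strip a" for x
  proof -
    have "(snd x)\<^sup>2 \<le> a\<^sup>2"
      using that \<open>a > 0\<close> by (auto simp: strip_def abs_le_square_iff[symmetric])
    then have "(snd x)\<^sup>2 * (k (fst x))\<^sup>2 \<le> a\<^sup>2 * (k (fst x))\<^sup>2"
      by (intro mult_right_mono) auto
    with kL[of "fst x"] L2 have "1 + (snd x)\<^sup>2 * (k (fst x))\<^sup>2 \<le> 2\<^sup>2" by simp
    then show ?thesis
      unfolding strip_h_def by (intro real_le_lsqrt) auto
  qed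
  have "isCont k s0" using k by (simp add: continuous_on_eq_continuous_at)
  then have "isCont (\<lambda>s. (k s)\<^sup>2 * (2 - L) / 32) s0" by (intro continuous_intros) auto
  moreover have "(k s0)\<^sup>2 * (2 - L) / 32 > 0" using k0 L2 by simp
  moreover have "(k s)\<^sup>2 * (2 - L) / 32 \<ge> 0" for s using L2 by simp
  ultimately obtain c \<beta> \<epsilon> where c: "c > 0" and \<beta>: "\<beta> > 0" and \<epsilon>: "0 \<le> \<epsilon>" "\<epsilon> \<le> 1"
    and weight: "\<And>s. 2 * c / (1 + (s - s0)\<^sup>2) \<le> (k s)\<^sup>2 * (2 - L) / 32
      + \<epsilon> / 2 * (((s - s0)\<^sup>2 / 4 - \<beta>\<^sup>2 / 2) / ((s - s0)\<^sup>2 + \<beta>\<^sup>2)\<^sup>2)"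
    using hardy_weight_le[of s0 "\<lambda>s. (k s)\<^sup>2 * (2 - L) / 32"] by blast
  define M where "M = strip_measure a (strip_h k)"
  define u where "u = (\<lambda>x. 1 / of_real (rho s0 x) :: complex)"
  have M: "M = density (lebesgue_on (strip a)) (\<lambda>x. ennreal (strip_h k x))"
    by (simp add: M_def strip_measure_def)
  have u: "u \<in> borel_measurable M" "\<And>x. norm (u x) \<le> 1"
    using rho_bounded_inverse by (simp_all add: u_def M)
  have hm: "strip_h k \<in> borel_measurable (lebesgue_on (strip a))"
    by (rule continuous_imp_measurable_on_sets_lebesgue[OF continuous_on_strip_h[OF k] sets_strip])
  have D: "\<phi> \<in> L2 M" if "\<phi> \<in> test_functions (strip a)" for \<phi>
    unfolding M
    by (rule L2_density_bounded(1)[OF test_functions_L2(1)[OF that \<open>a > 0\<close>] hm, where C = 2])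
      (use h2 order_trans[OF zero_le_one strip_h_ge_1] in auto)
  have test: "c * (L2norm M (\<lambda>x. \<phi> x * u x))\<^sup>2
      \<le> Q0_core a (strip_h k) \<phi> - E1 a * (L2norm M \<phi>)\<^sup>2"
    if "\<phi> \<in> test_functions (strip a)" for \<phi>
    using hardy_test_functions[OF that \<open>a > 0\<close> k L2 kL \<beta> \<epsilon> less_imp_le[OF c] weight]
    by (simp add: M_def u_def)
  show "\<exists>c>0. \<forall>\<psi>\<in>W012 (strip a).
       Q0 a (h0 \<tau> \<theta>) \<psi> - E1 a * (L2norm (strip_measure a (h0 \<tau> \<theta>)) \<psi>)\<^sup>2
         \<ge> c * (L2norm (strip_measure a (h0 \<tau> \<theta>)) (\<lambda>x. \<psi> x / of_real (rho s0 x)))\<^sup>2"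
  proof (intro exI[of _ c] conjI ballI c)
    fix \<psi> assume \<psi>: "\<psi> \<in> W012 (strip a)"
    \<comment> \<open>The choice in \<open>form_closure\<close> yields a value of the graph because
      one exists for every \<open>\<psi>\<close> in \<open>W012\<close>.\<close>
    have "form_closure_graph M (test_functions (strip a)) (Q0_core a (strip_h k)) \<psi>
        (Q0 a (strip_h k) \<psi>)"
      unfolding Q0_def form_closure_def M_def
      by (rule someI_ex[OF W012_imp_form_closure_graph[OF \<open>a > 0\<close> k h2 \<psi>]])
    from form_closure_graph_lower_bound[OF this D u test]
    show "c * (L2norm (strip_measure a (h0 \<tau> \<theta>)) (\<lambda>x. \<psi> x / of_real (rho s0 x)))\<^sup>2
        \<le> Q0 a (h0 \<tau> \<theta>) \<psi> - E1 a * (L2norm (strip_measure a (h0 \<tau> \<theta>)) \<psi>)\<^sup>2"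
      by (simp add: h M_def u_def)
  qed
qed

end
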